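(* Let $E=(N,C,A,k)$ be an election with $m=|C|$ candidates and let $W$ be the committee returned by Reverse Sequential PAV on $E$. If at most two candidates are deleted, i.e., if $r:=m-k\le 2$, then $W$ satisfies Extended Justified Representation (EJR).
   Context: An election is a tuple $E=(N,C,A,k)$, where $N=\{1,\ldots,n\}$ is a set of voters, $C$ is a set of $m$ candidates, $A=(A_i)_{i\in N}$ is a profile of approval ballots $A_i\subseteq C$, and $k$ is the desired committee size. It is assumed that $1\le k<m$ and that $A_i\ne\emptyset$ for at least one voter $i$. A committee is a set $W\subseteq C$ with $|W|=k$. For an integer $t\ge 0$, $H(t)=\sum_{j=1}^{t}1/j$ (so $H(0)=0$). For $S\subseteq C$, $\operatorname{PAV}(S)=\sum_{i\in N}H(|A_i\cap S|)$, and for $c\in S$ the marginal loss is $\Delta_S(c)=\operatorname{PAV}(S)-\operatorname{PAV}(S\setminus\{c\})$. Reverse Sequential PAV: let $C_m=C$; for $s=m,m-1,\ldots,k+1$ pick $c_s\in\arg\min_{c\in C_s}\Delta_{C_s}(c)$ and set $C_{s-1}=C_s\setminus\{c_s\}$; return $W=C_k$. Ties are resolved using a fixed priority (linear) order on candidates. For an integer $\ell\ge1$, a group of voters $V\subseteq N$ is $\ell$-cohesive if $|V|\ge \ell n/k$ and $|\bigcap_{i\in V}A_i|\ge \ell$. A committee $W$ satisfies EJR if for every integer $\ell\ge1$ and every $\ell$-cohesive group $V$ there is a voter $i\in V$ with $|A_i\cap W|\ge\ell$. *)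

theory Defs
  imports "HOL-Analysis.Harmonic_Numbers"
begin

definition is_election :: "nat \<Rightarrow> 'c set \<Rightarrow> (nat \<Rightarrow> 'c set) \<Rightarrow> nat \<Rightarrow> bool" where
  "is_election n C A k \<longleftrightarrow>
     finite C \<and> (\<forall>i\<in>{1..n}. A i \<subseteq> C) \<and> 1 \<le> k \<and> k < card C \<and> (\<exists>i\<in>{1..n}. A i \<noteq> {})"

definition is_committee :: "'c set \<Rightarrow> nat \<Rightarrow> 'c set \<Rightarrow> bool" where
  "is_committee C k W \<longleftrightarrow> W \<subseteq> C \<and> card W = k"

definition PAV :: "nat \<Rightarrow> (nat \<Rightarrow> 'c set) \<Rightarrow> 'c set \<Rightarrow> real" where
  "PAV n A S = (\<Sum>i\<in>{1..n}. harm (card (A i \<inter> S)))"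

definition marginal_loss :: "nat \<Rightarrow> (nat \<Rightarrow> 'c set) \<Rightarrow> 'c set \<Rightarrow> 'c \<Rightarrow> real" where
  "marginal_loss n A S c = PAV n A S - PAV n A (S - {c})"

definition loss_minimizers :: "nat \<Rightarrow> (nat \<Rightarrow> 'c set) \<Rightarrow> 'c set \<Rightarrow> 'c set" where
  "loss_minimizers n A S = {c. is_arg_min (marginal_loss n A S) (\<lambda>d. d \<in> S) c}"

text \<open>The relation \<open>R\<close> is the priority order: among tied candidates the \<open>R\<close>-least one is deleted.
  Results are to be stated for every linear order \<open>R\<close> on the candidates, so this choice of
  direction loses no generality.\<close>

definition deleted_candidate ::
  "'c rel \<Rightarrow> nat \<Rightarrow> (nat \<Rightarrow> 'c set) \<Rightarrow> 'c set \<Rightarrow> 'c" where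
  "deleted_candidate R n A S =
     (THE c. c \<in> loss_minimizers n A S \<and> (\<forall>d\<in>loss_minimizers n A S. (c, d) \<in> R))"

text \<open>\<open>after_deletions R n A C j\<close> is the candidate set left after \<open>j\<close> deletions, i.e. the set
  of size \<open>card C - j\<close> in the run of the rule.\<close>

primrec after_deletions ::
  "'c rel \<Rightarrow> nat \<Rightarrow> (nat \<Rightarrow> 'c set) \<Rightarrow> 'c set \<Rightarrow> nat \<Rightarrow> 'c set" where
  "after_deletions R n A C 0 = C"
| "after_deletions R n A C (Suc j) =
     after_deletions R n A C j - {deleted_candidate R n A (after_deletions R n A C j)}"

definition reverse_seq_PAV ::
  "'c rel \<Rightarrow> nat \<Rightarrow> 'c set \<Rightarrow> (nat \<Rightarrow> 'c set) \<Rightarrow> nat \<Rightarrow> 'c set" where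
  "reverse_seq_PAV R n C A k = after_deletions R n A C (card C - k)"

text \<open>In an election \<open>n \<ge> 1\<close> and \<open>k \<ge> 1\<close>, so for \<open>l \<ge> 1\<close> the size condition forces \<open>V\<close> to be
  nonempty and the intersection below is never the empty one.\<close>

definition cohesive :: "nat \<Rightarrow> (nat \<Rightarrow> 'c set) \<Rightarrow> nat \<Rightarrow> nat \<Rightarrow> nat set \<Rightarrow> bool" where
  "cohesive n A k l V \<longleftrightarrow>
     V \<subseteq> {1..n} \<and> real (card V) \<ge> real l * real n / real k \<and> card (\<Inter>i\<in>V. A i) \<ge> l"

definition EJR :: "nat \<Rightarrow> (nat \<Rightarrow> 'c set) \<Rightarrow> nat \<Rightarrow> 'c set \<Rightarrow> bool" where
  "EJR n A k W \<longleftrightarrow>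
     (\<forall>l\<ge>1. \<forall>V. cohesive n A k l V \<longrightarrow> (\<exists>i\<in>V. card (A i \<inter> W) \<ge> l))"

lemma linear_order_on_has_least:
  assumes "linear_order_on C R" "finite M" "M \<noteq> {}" "M \<subseteq> C"
  shows "\<exists>c\<in>M. \<forall>d\<in>M. (c, d) \<in> R"
  using assms(2-4)
proof (induction M rule: finite_ne_induct)
  case (singleton x)
  then show ?case
    using assms(1) by (auto simp: order_on_defs refl_on_def)
next
  case (insert x F)
  then obtain c where c: "c \<in> F" "\<forall>d\<in>F. (c, d) \<in> R" by auto
  have xx: "(x, x) \<in> R" and tr: "trans R"
    using assms(1) insert.prems by (auto simp: order_on_defs refl_on_def)
  have "(x, c) \<in> R \<or> (c, x) \<in> R"
    using assms(1) insert c by (auto simp: order_on_defs total_on_def)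
  then show ?case
    using c xx tr by (metis insert_iff transD)
qed

lemma deleted_candidate_minimizes:
  assumes R: "linear_order_on C R" and S: "finite S" "S \<noteq> {}" "S \<subseteq> C"
  shows "deleted_candidate R n A S \<in> loss_minimizers n A S"
    and "\<And>d. d \<in> loss_minimizers n A S \<Longrightarrow> (deleted_candidate R n A S, d) \<in> R"
proof -
  let ?M = "loss_minimizers n A S"
  have sub: "?M \<subseteq> S" by (auto simp: loss_minimizers_def is_arg_min_def)
  obtain c where "c \<in> S" "\<forall>d\<in>S. marginal_loss n A S c \<le> marginal_loss n A S d"
    using S by (metis arg_min_if_finite(1) arg_min_least)
  then have "c \<in> ?M" by (auto simp: loss_minimizers_def is_arg_min_linorder)
  then obtain e where e: "e \<in> ?M" "\<forall>d\<in>?M. (e, d) \<in> R"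
    using linear_order_on_has_least[OF R, of ?M] sub S
    by (metis empty_iff finite_subset subset_trans)
  have "antisym R" using R by (simp add: order_on_defs)
  then have "\<exists>!c. c \<in> ?M \<and> (\<forall>d\<in>?M. (c, d) \<in> R)"
    using e by (meson antisymD)
  from theI'[OF this]
  show "deleted_candidate R n A S \<in> ?M"
    and "\<And>d. d \<in> ?M \<Longrightarrow> (deleted_candidate R n A S, d) \<in> R"
    by (auto simp: deleted_candidate_def)
qed

lemma after_deletions_committee:
  assumes "finite C" "linear_order_on C R" "j \<le> card C"
  shows "is_committee C (card C - j) (after_deletions R n A C j)"
  using assms(3)
proof (induction j)
  case 0
  then show ?case by (simp add: is_committee_def)
next
  case (Suc j)
  let ?S = "after_deletions R n A C j"
  have S: "?S \<subseteq> C" "card ?S = card C - j"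
    using Suc by (auto simp: is_committee_def)
  then have fin: "finite ?S" and ne: "?S \<noteq> {}"
    using assms(1) Suc.prems by (auto intro: finite_subset)
  have "deleted_candidate R n A ?S \<in> ?S"
    using deleted_candidate_minimizes(1)[OF assms(2) fin ne S(1), of n A]
    by (simp add: loss_minimizers_def is_arg_min_def)
  then show ?case
    using S fin by (auto simp: is_committee_def card_Diff_singleton)
qed

lemma reverse_seq_PAV_committee:
  assumes "is_election n C A k" "linear_order_on C R"
  shows "is_committee C k (reverse_seq_PAV R n C A k)"
  using after_deletions_committee[of C R "card C - k" n A] assms
  by (simp add: reverse_seq_PAV_def is_election_def)

end

theory Submission
  imports Defs
begin

text \<open>The marginal losses of the members of \<open>S\<close> add up to at most \<open>n\<close>, so the last deleted
  candidate has loss at most \<open>n / (k + 1)\<close>. Exchanging the order of two consecutive deletions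
  \<open>c1\<close>, \<open>c2\<close> does not raise the last loss: the total loss of the two is the same in both
  orders, and \<open>c1\<close> was the cheapest first deletion. So if at most two candidates are deleted, then
  adding back any deleted candidate \<open>c\<close> raises the PAV score of \<open>W\<close> by at most
  \<open>n / (k + 1) < n / k\<close>. If EJR failed for an \<open>l\<close>-cohesive group \<open>V\<close>, the group would
  jointly approve some \<open>c\<close> outside \<open>W\<close>, and adding \<open>c\<close> would raise the score by at
  least \<open>card V / l\<close>, which is at least \<open>n / k\<close>.\<close>

text \<open>Deleting \<open>c\<close> affects only its approvers, and each of them loses the last
  term of their harmonic sum.\<close>

lemma marginal_loss_eq_sum:
  assumes "finite S" "c \<in> S"
  shows "marginal_loss n A S c = (\<Sum>i\<in>{1..n}. if c \<in> A i then 1 / real (card (A i \<inter> S)) else 0)"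
proof -
  have "harm (card (A i \<inter> S)) - harm (card (A i \<inter> (S - {c})))
      = (if c \<in> A i then 1 / real (card (A i \<inter> S)) else 0)" for i
  proof (cases "c \<in> A i")
    case True
    have "A i \<inter> S = insert c (A i \<inter> (S - {c}))"
      using True assms(2) by auto
    then have "card (A i \<inter> S) = Suc (card (A i \<inter> (S - {c})))"
      using assms(1) by (metis Diff_iff IntE card_insert_disjoint finite_Diff finite_Int singletonI)
    then show ?thesis
      using True by (simp add: harm_Suc inverse_eq_divide)
  next
    case False
    then have "A i \<inter> (S - {c}) = A i \<inter> S" by auto
    then show ?thesis using False by simp
  qed
  then show ?thesis
    by (simp add: marginal_loss_def PAV_def flip: sum_subtractf)
qed

lemma sum_marginal_loss_le:
  assumes "finite S"
  shows "(\<Sum>c\<in>S. marginal_loss n A S c) \<le> real n"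
proof -
  have voter: "(\<Sum>c\<in>S. if c \<in> A i then 1 / real (card (A i \<inter> S)) else 0) \<le> 1" for i
  proof -
    have "(\<Sum>c\<in>S. if c \<in> A i then 1 / real (card (A i \<inter> S)) else 0)
        = (\<Sum>c\<in>S \<inter> A i. 1 / real (card (A i \<inter> S)))"
      by (rule sum.inter_restrict[OF assms, symmetric])
    \<comment> \<open>The sum has \<open>card (A i \<inter> S)\<close> equal terms, so it is 1, or 0
      for a voter who approves nothing in \<open>S\<close>.\<close>
    also have "\<dots> \<le> 1"
      by (simp add: Int_commute)
    finally show ?thesis .
  qed
  have "(\<Sum>c\<in>S. marginal_loss n A S c)
      = (\<Sum>c\<in>S. \<Sum>i\<in>{1..n}. if c \<in> A i then 1 / real (card (A i \<inter> S)) else 0)"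
    using assms by (intro sum.cong refl marginal_loss_eq_sum)
  also have "\<dots> = (\<Sum>i\<in>{1..n}. \<Sum>c\<in>S. if c \<in> A i then 1 / real (card (A i \<inter> S)) else 0)"
    by (rule sum.swap)
  also have "\<dots> \<le> (\<Sum>i\<in>{1..n}. 1)"
    by (intro sum_mono voter)
  finally show ?thesis by simp
qed

lemma loss_minimizer_le_average:
  assumes "finite S" "c \<in> loss_minimizers n A S"
  shows "marginal_loss n A S c \<le> real n / real (card S)"
proof -
  have c: "c \<in> S" "\<And>d. d \<in> S \<Longrightarrow> marginal_loss n A S c \<le> marginal_loss n A S d"
    using assms(2) by (auto simp: loss_minimizers_def is_arg_min_linorder)
  have "real (card S) * marginal_loss n A S c \<le> (\<Sum>d\<in>S. marginal_loss n A S d)"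
    using c(2) by (intro sum_bounded_below) auto
  also have "\<dots> \<le> real n"
    using assms(1) by (rule sum_marginal_loss_le)
  finally have "real (card S) * marginal_loss n A S c \<le> real n" .
  moreover have "card S > 0"
    using assms(1) c(1) by (auto simp: card_gt_0_iff)
  ultimately show ?thesis by (simp add: field_simps)
qed

lemma marginal_loss_exchange:
  assumes "c \<in> loss_minimizers n A S" "d \<in> S"
  shows "marginal_loss n A (S - {d}) c \<le> marginal_loss n A (S - {c}) d"
proof -
  have "marginal_loss n A S c \<le> marginal_loss n A S d"
    using assms by (auto simp: loss_minimizers_def is_arg_min_linorder)
  moreover have "S - {d} - {c} = S - {c} - {d}" by auto
  ultimately show ?thesis by (simp add: marginal_loss_def)
qed

text \<open>A group violating EJR would yield a candidate whose addition gains at least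
  \<open>n / k\<close>. That candidate is approved by a voter, so \<open>gain\<close> can be limited
  to approved candidates and no candidate set needs to be mentioned.\<close>

lemma EJR_if_marginal_gains_small:
  assumes "finite W" "n > 0" "k > 0"
    and gain: "\<And>i c. i \<in> {1..n} \<Longrightarrow> c \<in> A i \<Longrightarrow> c \<notin> W \<Longrightarrow>
      marginal_loss n A (insert c W) c < real n / real k"
  shows "EJR n A k W"
  unfolding EJR_def
proof (intro allI impI)
  fix l :: nat and V
  assume l: "l \<ge> 1" and "cohesive n A k l V"
  then have V: "V \<subseteq> {1..n}" "real (card V) \<ge> real l * real n / real k" "card (\<Inter>i\<in>V. A i) \<ge> l"
    by (auto simp: cohesive_def)
  have finV: "finite V" using V(1) finite_subset by blast
  show "\<exists>i\<in>V. card (A i \<inter> W) \<ge> l"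
  proof (rule ccontr)
    assume "\<not> ?thesis"
    then have small: "card (A i \<inter> W) < l" if "i \<in> V" for i
      using that by (simp add: not_le)
    have "real l * real n / real k > 0"
      using l assms by simp
    then have "V \<noteq> {}" using V(2) by auto
    then obtain j where j: "j \<in> V" by blast
    \<comment> \<open>The group shares at least \<open>l\<close> candidates, but \<open>W\<close>
      contains fewer than \<open>l\<close> of those approved by \<open>j\<close>.\<close>
    have "\<not> (\<Inter>i\<in>V. A i) \<subseteq> W"
    proof
      assume "(\<Inter>i\<in>V. A i) \<subseteq> W"
      then have "(\<Inter>i\<in>V. A i) \<subseteq> A j \<inter> W" using j by auto
      then have "card (\<Inter>i\<in>V. A i) \<le> card (A j \<inter> W)"
        using assms(1) by (intro card_mono) auto
      then show False using V(3) small[OF j] by simp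
    qed
    then obtain c where c: "\<And>i. i \<in> V \<Longrightarrow> c \<in> A i" "c \<notin> W" by auto
    let ?g = "\<lambda>i. if c \<in> A i then 1 / real (card (A i \<inter> insert c W)) else 0"
    \<comment> \<open>At most \<open>l - 1\<close> approved candidates lie in \<open>W\<close>,
      hence at most \<open>l\<close> in \<open>insert c W\<close>.\<close>
    have voter: "1 / real l \<le> ?g i" if "i \<in> V" for i
    proof -
      have "card (A i \<inter> insert c W) = Suc (card (A i \<inter> W))"
        using c that assms(1) by simp
      then show ?thesis
        using c(1)[OF that] small[OF that] by (simp add: frac_le)
    qed
    have "real n / real k \<le> real (card V) * (1 / real l)"
      using V(2) l assms by (simp add: field_simps)
    also have "\<dots> \<le> (\<Sum>i\<in>V. ?g i)"
      using voter by (intro sum_bounded_below)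
    also have "\<dots> \<le> (\<Sum>i\<in>{1..n}. ?g i)"
      using V(1) by (intro sum_mono2) auto
    also have "\<dots> = marginal_loss n A (insert c W) c"
      using assms(1) by (simp add: marginal_loss_eq_sum)
    also have "\<dots> < real n / real k"
      using gain[of j c] V(1) j c by auto
    finally show False by simp
  qed
qed

theorem theorem1:
  fixes n k :: nat and C W :: "'c set" and A :: "nat \<Rightarrow> 'c set" and R :: "'c rel"
  assumes "is_election n C A k"
    and "linear_order_on C R"
    and "W = reverse_seq_PAV R n C A k"
    and "card C - k \<le> 2"
  shows "EJR n A k W"
proof -
  have C: "finite C" "\<And>i. i \<in> {1..n} \<Longrightarrow> A i \<subseteq> C" "k > 0" "k < card C" "n > 0"
    using assms(1) by (auto simp: is_election_def)
  have minimizer: "deleted_candidate R n A S \<in> loss_minimizers n A S" if "S \<subseteq> C" "S \<noteq> {}" for S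
    using deleted_candidate_minimizes(1)[OF assms(2)] that C(1) by (meson finite_subset)
  have mem: "c \<in> S" if "c \<in> loss_minimizers n A S" for c S
    using that by (simp add: loss_minimizers_def is_arg_min_linorder)
  have "finite W"
    using reverse_seq_PAV_committee[OF assms(1,2)] C assms(3)
    by (auto simp: is_committee_def intro: finite_subset)
  have average: "marginal_loss n A S c < real n / real k"
    if "S \<subseteq> C" "card S = k + 1" "c \<in> loss_minimizers n A S" for S c
  proof -
    have "marginal_loss n A S c \<le> real n / real (k + 1)"
      using loss_minimizer_le_average[OF _ that(3)] that C(1) by (metis finite_subset)
    \<comment> \<open>The last deletion is made from \<open>k + 1\<close> candidates, not
      \<open>k\<close>; this gives the strict inequality.\<close>
    also have "\<dots> < real n / real k"
      using C by (simp add: field_simps)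
    finally show ?thesis .
  qed
  have "marginal_loss n A (insert c W) c < real n / real k" if c: "c \<in> C" "c \<notin> W" for c
  proof -
    define c1 where "c1 = deleted_candidate R n A C"
    have c1: "c1 \<in> loss_minimizers n A C"
      using minimizer[of C] c(1) unfolding c1_def by auto
    then have mem1: "c1 \<in> C" by (rule mem)
    consider "card C - k = 1" | "card C - k = 2"
      using assms(4) C(4) by linarith
    then show ?thesis
    proof cases
      case 1
      then have "W = C - {c1}"
        by (simp add: assms(3) reverse_seq_PAV_def c1_def)
      then have "c = c1" "insert c W = C" using c mem1 by auto
      then show ?thesis using average[of C c1] c1 1 C by simp
    next
      case 2
      define c2 where "c2 = deleted_candidate R n A (C - {c1})"
      have W: "W = C - {c1} - {c2}"
        using 2 by (simp add: assms(3) reverse_seq_PAV_def c1_def c2_def numeral_2_eq_2)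
      have card: "card (C - {c1}) = k + 1"
        using 2 C mem1 by simp
      then have "C - {c1} \<noteq> {}" by (metis add_is_0 card.empty one_neq_zero)
      then have c2: "c2 \<in> loss_minimizers n A (C - {c1})"
        using minimizer[of "C - {c1}"] unfolding c2_def by auto
      then have mem2: "c2 \<in> C - {c1}" by (rule mem)
      have last: "marginal_loss n A (C - {c1}) c2 < real n / real k"
        using average card c2 by blast
      show ?thesis
      proof (cases "c = c2")
        case True
        then have "insert c W = C - {c1}" using W mem2 by auto
        then show ?thesis using last True by simp
      next
        case False
        \<comment> \<open>Adding \<open>c1\<close> back gives the set that would remain had
          \<open>c2\<close> been deleted first, so the exchange bounds the gain by the actual last
          loss.\<close>
        then have "c = c1" "insert c W = C - {c2}" using W c mem2 by auto
        then show ?thesis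
          using marginal_loss_exchange[OF c1, of c2] mem2 last by simp
      qed
    qed
  qed
  then show ?thesis
    using C \<open>finite W\<close> by (intro EJR_if_marginal_gains_small) auto
qed

end
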